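(* Let $R(n)$ stand for the maximum cardinality of a family of pairwise two-separated (directed) Hamilton paths in the symmetrically complete directed graph $K_n$. Then $$\frac{n!}{n^{13}5^{n-10}}\leq R(n) \leq \frac{n!}{2^{\lfloor n/2 \rfloor}}.$$
   Context: Here $K_n$ denotes the symmetrically complete directed graph with vertex set $[n]=\{1,2,\dots,n\}$, in which every pair of distinct vertices is connected by two edges going in opposite directions. A Hamilton path in it is a consecutively oriented directed path through all vertices; such paths are identified with permutations (linear orders) $\pi_1\pi_2\cdots\pi_n$ of $[n]$. In a directed graph, the (open) 2-out-neighbourhood of a vertex $a$ consists of the vertices reachable from $a$ by a (consecutively oriented) path of at most two edges, $a$ itself not included. Two directed Hamilton paths in $K_n$ are called two-separated if for at least one vertex $a\in[n]$ the union of the 2-out-neighbourhood of $a$ in the first path and the 2-out-neighbourhood of $a$ in the second path contains exactly $4$ vertices. Equivalently, for some $a\in[n]$, $a$ is immediately followed by $x,y$ in one of the two permutations and immediately followed by $v,w$ in the other, where $x,y,v,w$ are four different elements of $[n]$. A family is pairwise two-separated if any two distinct members of it are two-separated.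
   Formalization: The bounds are stated for n ≥ 3 only: for n = 1 and n = 2 the lower bound as printed equals 5^9 and about 95.4, while R(n) = 1, so the displayed inequality is false there, and for n = 0 its denominator is zero. *)

theory Defs
  imports "Graph_Theory.Graph_Theory" "HOL-Combinatorics.Multiset_Permutations"
begin

definition K_sym :: "nat \<Rightarrow> nat pair_pre_digraph" where
  "K_sym n = \<lparr> pverts = {1..n}, parcs = {(u, v). u \<in> {1..n} \<and> v \<in> {1..n} \<and> u \<noteq> v} \<rparr>"

definition hamilton_path :: "'a vwalk \<Rightarrow> ('a, 'b) pre_digraph \<Rightarrow> bool" where
  "hamilton_path p G \<longleftrightarrow> vpath p G \<and> set p = verts G"

text \<open>A path, given by its list of vertices, regarded as a directed graph of its own.\<close>

definition path_digraph :: "'a vwalk \<Rightarrow> 'a pair_pre_digraph" where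
  "path_digraph p = \<lparr> pverts = set p, parcs = set (vwalk_arcs p) \<rparr>"

definition two_out_nbhd :: "('a, 'b) pre_digraph \<Rightarrow> 'a \<Rightarrow> 'a set" where
  "two_out_nbhd G a =
    {b. b \<noteq> a \<and> (\<exists>q. vpath q G \<and> vwalk_length q \<le> 2 \<and> hd q = a \<and> last q = b)}"

definition two_separated :: "'a vwalk \<Rightarrow> 'a vwalk \<Rightarrow> bool" where
  "two_separated p q \<longleftrightarrow>
    (\<exists>a \<in> set p \<union> set q. card (two_out_nbhd (path_digraph p) a \<union> two_out_nbhd (path_digraph q) a) = 4)"

definition R :: "nat \<Rightarrow> nat" where
  "R n = Max (card ` {F. F \<subseteq> {p. hamilton_path p (K_sym n)} \<and> pairwise two_separated F})"

lemma complete_digraph_K_sym: "K\<^bsub>n\<^esub> (with_proj (K_sym n))"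
  unfolding complete_digraph_pair_def by (auto simp: K_sym_def)

lemma vwalk_arcs_K_sym:
  "distinct p \<Longrightarrow> set p \<subseteq> {1..n} \<Longrightarrow> set (vwalk_arcs p) \<subseteq> parcs (K_sym n)"
  by (induction p rule: vwalk_arcs.induct) (auto simp: K_sym_def)

lemma hamilton_paths_K_sym:
  assumes "n \<ge> 1"
  shows "{p. hamilton_path p (with_proj (K_sym n))} = permutations_of_set {1..n}"
proof -
  have "hamilton_path p (with_proj (K_sym n)) \<longleftrightarrow> distinct p \<and> set p = {1..n}" for p
    using assms vwalk_arcs_K_sym[of p n]
    by (auto simp: hamilton_path_def vpath_def vwalk_def K_sym_def)
  then show ?thesis
    by (auto simp: permutations_of_set_def)
qed

lemma finite_two_separated_families:
  assumes "n \<ge> 1"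
  shows "finite {F. F \<subseteq> {p. hamilton_path p (K_sym n)} \<and> pairwise two_separated F}"
proof -
  have "finite {p. hamilton_path p (with_proj (K_sym n))}"
    by (simp only: hamilton_paths_K_sym[OF assms]) simp
  then show ?thesis by simp
qed

lemma path_digraph_simps [simp]:
  "pverts (path_digraph p) = set p" "parcs (path_digraph p) = set (vwalk_arcs p)"
  by (auto simp: path_digraph_def)

end

theory Submission
  imports Defs
begin

text \<open>
  Upper bound. Cut the positions \<open>0, \<dots>, n - 1\<close> into \<open>n div 2\<close> consecutive pairs and switch the
  entries within an arbitrary set of these pairs. Such a change never produces a two-separated
  permutation: the two entries of a pair are still followed by each other or by entries of
  the next pair, and among so few candidates the successors cannot be disjoint
  (\<open>not_two_separated_switch\<close>). The switchings form a group that acts freely on the permutations,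
  so the orbits have \<open>2 ^ (n div 2)\<close> elements each, and a pairwise two-separated family meets every
  orbit at most once.

  Lower bound. This is the Gilbert--Varshamov argument: if a family is of maximal size, then the
  balls \<open>{p. \<not> two_separated q p}\<close> around its members \<open>q\<close> cover all permutations, so that
  \<open>fact n\<close> is at most \<open>R n\<close> times the size of a ball. To bound a ball, let \<open>P k\<close> be the position
  in \<open>p\<close> of the entry at position \<open>k\<close> of \<open>q\<close>. If \<open>p\<close> lies in the ball, then for every \<open>k\<close> such
  that neither \<open>k\<close> nor \<open>P k\<close> is one of the last two positions, the common successor yields
  \<open>i, j \<in> {1, 2}\<close> with \<open>P (k + i) = P k + j\<close>. Fix such a pair \<open>(i, j)\<close> for each \<open>k\<close>; there are
  \<open>4 ^ n\<close> possible choices. Given the choices, \<open>P k\<close> is determined by the value of \<open>P\<close> at a larger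
  argument. Following these references upwards from any \<open>k\<close>, one ends at an argument where \<open>P\<close> has
  to be known in advance: one of the last two positions, or one that \<open>P\<close> sends there. At most four
  numbers below \<open>n\<close> supply this information, whence the ball has at most \<open>n ^ 4 * 4 ^ n\<close> elements
  (\<open>card_local_bijections_le\<close>). For \<open>n \<ge> 6\<close> this is at most \<open>n ^ 13 * 5 ^ n / 5 ^ 10\<close>, because
  \<open>5 ^ 10 \<le> 6 ^ 9\<close>; for smaller \<open>n\<close> the claimed lower bound is at most 1.
\<close>

section \<open>Out-neighbourhoods in a path\<close>

lemma vwalk_arcs_iff_nth:
  "(u, v) \<in> set (vwalk_arcs p) \<longleftrightarrow> (\<exists>i. Suc i < length p \<and> u = p ! i \<and> v = p ! Suc i)"
proof (induction p rule: vwalk_arcs.induct)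
  case (3 x y zs)
  show ?case
  proof
    assume "(u, v) \<in> set (vwalk_arcs (x # y # zs))"
    then consider "u = x" "v = y" | "(u, v) \<in> set (vwalk_arcs (y # zs))" by auto
    then show "\<exists>i. Suc i < length (x # y # zs) \<and> u = (x # y # zs) ! i \<and> v = (x # y # zs) ! Suc i"
    proof cases
      case 1 then show ?thesis by (intro exI[of _ 0]) simp
    next
      case 2
      then obtain i where "Suc i < length (y # zs)" "u = (y # zs) ! i" "v = (y # zs) ! Suc i"
        using 3 by blast
      then show ?thesis by (intro exI[of _ "Suc i"]) simp
    qed
  next
    assume "\<exists>i. Suc i < length (x # y # zs) \<and> u = (x # y # zs) ! i \<and> v = (x # y # zs) ! Suc i"
    then obtain i where i: "Suc i < length (x # y # zs)" "u = (x # y # zs) ! i" "v = (x # y # zs) ! Suc i"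
      by blast
    show "(u, v) \<in> set (vwalk_arcs (x # y # zs))"
    proof (cases i)
      case 0 with i show ?thesis by simp
    next
      case (Suc j)
      with i have "\<exists>i. Suc i < length (y # zs) \<and> u = (y # zs) ! i \<and> v = (y # zs) ! Suc i"
        by (intro exI[of _ j]) simp
      then show ?thesis using 3 by simp
    qed
  qed
qed simp_all

lemma two_out_nbhd_iff:
  "b \<in> two_out_nbhd (with_proj G) a \<longleftrightarrow>
   b \<noteq> a \<and> a \<in> pverts G \<and> b \<in> pverts G \<and>
   ((a, b) \<in> parcs G \<or> (\<exists>c \<in> pverts G. c \<noteq> a \<and> c \<noteq> b \<and> (a, c) \<in> parcs G \<and> (c, b) \<in> parcs G))"
    (is "?l \<longleftrightarrow> ?r")
proof
  assume ?l
  then obtain q where q: "vpath q (with_proj G)" "vwalk_length q \<le> 2" "hd q = a" "last q = b"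
    and ne: "b \<noteq> a" by (auto simp: two_out_nbhd_def)
  from q(1) have "q \<noteq> []" by (auto simp: vpath_def vwalk_def)
  with q(2) have "length q \<le> 3" by (cases q) (auto simp: vwalk_length_def)
  then consider "q = []" | x where "q = [x]" | x y where "q = [x, y]" | x y z where "q = [x, y, z]"
    by (cases q; cases "tl q"; cases "tl (tl q)"; cases "tl (tl (tl q))") auto
  then show ?r
    using q ne by cases (auto simp: vpath_def vwalk_def)
next
  assume r: ?r
  then consider "(a, b) \<in> parcs G" | c where "c \<in> pverts G" "c \<noteq> a" "c \<noteq> b" "(a, c) \<in> parcs G" "(c, b) \<in> parcs G"
    by blast
  then show ?l
  proof cases
    case 1
    with r show ?thesis by (auto intro!: exI[of _ "[a, b]"] simp: two_out_nbhd_def vpath_def vwalk_def vwalk_length_def)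
  next
    case 2
    with r show ?thesis by (auto intro!: exI[of _ "[a, c, b]"] simp: two_out_nbhd_def vpath_def vwalk_def vwalk_length_def)
  qed
qed

lemma two_out_nbhd_path_digraph:
  assumes "distinct p" "k < length p"
  shows "two_out_nbhd (path_digraph p) (p ! k) = (!) p ` {j \<in> {k + 1, k + 2}. j < length p}"
proof -
  have arc: "(p ! i, p ! j) \<in> parcs (path_digraph p) \<longleftrightarrow> j = Suc i"
    if "i < length p" "j < length p" for i j
    using that assms(1) by (auto simp: vwalk_arcs_iff_nth nth_eq_iff_index_eq)
  have "b \<in> two_out_nbhd (path_digraph p) (p ! k) \<longleftrightarrow> b \<in> (!) p ` {j \<in> {k + 1, k + 2}. j < length p}" for b
  proof (cases "b \<in> set p")
    case True
    then obtain j where j: "j < length p" "b = p ! j" by (metis in_set_conv_nth)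
    have "b \<in> two_out_nbhd (path_digraph p) (p ! k) \<longleftrightarrow>
       p ! j \<noteq> p ! k \<and> ((p ! k, p ! j) \<in> parcs (path_digraph p) \<or>
         (\<exists>i < length p. p ! i \<noteq> p ! k \<and> p ! i \<noteq> p ! j \<and>
           (p ! k, p ! i) \<in> parcs (path_digraph p) \<and> (p ! i, p ! j) \<in> parcs (path_digraph p)))"
      using j assms(2) by (simp add: two_out_nbhd_iff Bex_def in_set_conv_nth del: path_digraph_simps(2)) blast
    also have "\<dots> \<longleftrightarrow>
       j \<noteq> k \<and> (j = Suc k \<or> (\<exists>i < length p. i \<noteq> k \<and> i \<noteq> j \<and> i = Suc k \<and> j = Suc i))"
      using j assms by (simp only: nth_eq_iff_index_eq arc cong: conj_cong)
    also have "\<dots> \<longleftrightarrow> b \<in> (!) p ` {j \<in> {k + 1, k + 2}. j < length p}"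
      using j assms by (auto simp: nth_eq_iff_index_eq image_iff)
    finally show ?thesis .
  next
    case False
    then have "b \<notin> two_out_nbhd (path_digraph p) (p ! k)"
      by (simp add: two_out_nbhd_iff)
    with False show ?thesis by auto
  qed
  then show ?thesis by blast
qed

lemma two_separated_sym: "two_separated p q \<longleftrightarrow> two_separated q p"
  by (simp add: two_separated_def Un_commute)

text \<open>
  A vertex has at most two out-neighbours in each path, so a union of size 4 forces two of them in
  each path, none of them shared. From here on only lists and positions matter.
\<close>

lemma two_separated_iff_positions:
  assumes p: "p \<in> permutations_of_set A" and q: "q \<in> permutations_of_set A"
  shows "two_separated p q \<longleftrightarrow>
    (\<exists>k l. k + 2 < card A \<and> l + 2 < card A \<and> p ! k = q ! l \<and>
       {p ! (k + 1), p ! (k + 2)} \<inter> {q ! (l + 1), q ! (l + 2)} = {})"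
    (is "_ \<longleftrightarrow> ?r")
proof -
  have len: "length p = card A" "length q = card A" and d: "distinct p" "distinct q"
    and s: "set p = A" "set q = A"
    using p q by (auto simp: length_finite_permutations_of_set dest: permutations_of_setD)
  have nb: "two_out_nbhd (path_digraph r) (r ! i) = {r ! (i + 1), r ! (i + 2)}"
    if "i + 2 < length r" "distinct r" for r :: "'a list" and i
  proof -
    have "{j \<in> {i + 1, i + 2}. j < length r} = {i + 1, i + 2}" using that by auto
    then show ?thesis using that by (simp add: two_out_nbhd_path_digraph)
  qed
  have card2: "card (two_out_nbhd (path_digraph r) (r ! i)) \<le> 2"
      "\<not> i + 2 < length r \<Longrightarrow> card (two_out_nbhd (path_digraph r) (r ! i)) \<le> 1"
    if "i < length r" "distinct r" for r :: "'a list" and i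
  proof -
    have eq: "two_out_nbhd (path_digraph r) (r ! i) = (!) r ` {j \<in> {i + 1, i + 2}. j < length r}"
      using that by (simp add: two_out_nbhd_path_digraph)
    have "card {j \<in> {i + 1, i + 2}. j < length r} \<le> card {i + 1, i + 2}"
      by (intro card_mono) auto
    then show "card (two_out_nbhd (path_digraph r) (r ! i)) \<le> 2"
      unfolding eq by (intro order_trans[OF card_image_le]) auto
    assume "\<not> i + 2 < length r"
    then have "card {j \<in> {i + 1, i + 2}. j < length r} \<le> card {i + 1}"
      by (intro card_mono) auto
    then show "card (two_out_nbhd (path_digraph r) (r ! i)) \<le> 1"
      unfolding eq by (intro order_trans[OF card_image_le]) auto
  qed
  show ?thesis
  proof
    assume "two_separated p q"
    then obtain a where a: "a \<in> A"
      and c: "card (two_out_nbhd (path_digraph p) a \<union> two_out_nbhd (path_digraph q) a) = 4"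
      using s by (auto simp: two_separated_def)
    obtain k l where kl: "k < card A" "l < card A" "a = p ! k" "a = q ! l"
      using a s len by (metis in_set_conv_nth)
    have un: "card (two_out_nbhd (path_digraph p) (p ! k) \<union> two_out_nbhd (path_digraph q) (q ! l))
      \<le> card (two_out_nbhd (path_digraph p) (p ! k)) + card (two_out_nbhd (path_digraph q) (q ! l))"
      by (rule card_Un_le)
    have kl2: "k + 2 < card A" "l + 2 < card A"
      using un c kl card2[of k p] card2[of l q] len d by fastforce+
    moreover have "{p ! (k + 1), p ! (k + 2)} \<inter> {q ! (l + 1), q ! (l + 2)} = {}"
    proof (rule ccontr)
      assume ne: "{p ! (k + 1), p ! (k + 2)} \<inter> {q ! (l + 1), q ! (l + 2)} \<noteq> {}"
      have "card ({p ! (k + 1), p ! (k + 2)} \<inter> {q ! (l + 1), q ! (l + 2)}) \<ge> 1"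
        using ne by (metis One_nat_def Suc_leI card_gt_0_iff finite.emptyI finite.insertI finite_Int)
      moreover have "card {p ! (k + 1), p ! (k + 2)} \<le> 2" "card {q ! (l + 1), q ! (l + 2)} \<le> 2"
        using card_insert_le_m1 by (auto simp: card_insert_if)
      ultimately have "card ({p ! (k + 1), p ! (k + 2)} \<union> {q ! (l + 1), q ! (l + 2)}) \<le> 3"
        using card_Un_Int[of "{p ! (k + 1), p ! (k + 2)}" "{q ! (l + 1), q ! (l + 2)}"] by simp
      then show False using c nb[of k p] nb[of l q] kl kl2 len d by (simp add: insert_commute)
    qed
    ultimately show ?r using kl by metis
  next
    assume ?r
    then obtain k l where kl: "k + 2 < card A" "l + 2 < card A" "p ! k = q ! l"
      and dis: "{p ! (k + 1), p ! (k + 2)} \<inter> {q ! (l + 1), q ! (l + 2)} = {}" by blast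
    have "card ({p ! (k + 1), p ! (k + 2)} \<union> {q ! (l + 1), q ! (l + 2)}) =
        card {p ! (k + 1), p ! (k + 2)} + card {q ! (l + 1), q ! (l + 2)}"
      using dis by (intro card_Un_disjoint) auto
    also have "\<dots> = 4" using kl len d by (simp add: nth_eq_iff_index_eq)
    finally have "card (two_out_nbhd (path_digraph p) (p ! k) \<union> two_out_nbhd (path_digraph q) (p ! k)) = 4"
      using nb[of k p] nb[of l q] kl len d by simp
    moreover have "p ! k \<in> set p" using kl len by (intro nth_mem) simp
    ultimately show "two_separated p q" by (auto simp: two_separated_def)
  qed
qed

section \<open>Upper bound: switching consecutive pairs\<close>

text \<open>
  The set \<open>T\<close> holds the indices of the pairs \<open>{2 * i, 2 * i + 1}\<close> of positions that are exchanged.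
\<close>

definition switch_index :: "nat set \<Rightarrow> nat \<Rightarrow> nat" where
  "switch_index T j = (if j div 2 \<in> T then (if even j then j + 1 else j - 1) else j)"

definition switch :: "nat set \<Rightarrow> 'a list \<Rightarrow> 'a list" where
  "switch T p = map (\<lambda>j. p ! switch_index T j) [0..<length p]"

lemma switch_index_switch_index:
  "switch_index S (switch_index T j) = switch_index (sym_diff S T) j"
  unfolding switch_index_def by (auto elim!: evenE oddE)

lemma switch_index_empty [simp]: "switch_index {} j = j"
  by (simp add: switch_index_def)

lemma switch_index_less:
  assumes "T \<subseteq> {..<n div 2}" "j < n"
  shows "switch_index T j < n"
proof (cases "j div 2 \<in> T")
  case True
  then have "j div 2 < n div 2" using assms by auto
  then show ?thesis using assms(2) by (auto simp: switch_index_def elim!: evenE)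
qed (use assms in \<open>simp add: switch_index_def\<close>)

lemma length_switch [simp]: "length (switch T p) = length p"
  by (simp add: switch_def)

lemma nth_switch: "j < length p \<Longrightarrow> switch T p ! j = p ! switch_index T j"
  by (simp add: switch_def)

lemma switch_switch:
  assumes "T \<subseteq> {..<length p div 2}"
  shows "switch T (switch S p) = switch (sym_diff S T) p"
  using switch_index_less[OF assms]
  by (intro nth_equalityI) (auto simp: nth_switch switch_index_switch_index)

lemma switch_empty [simp]: "switch {} p = p"
  by (intro nth_equalityI) (auto simp: nth_switch)

lemma switch_permutation:
  assumes "p \<in> permutations_of_set A" "T \<subseteq> {..<card A div 2}"
  shows "switch T p \<in> permutations_of_set A"
proof -
  have p: "length p = card A" "distinct p" "set p = A"
    using assms by (auto simp: length_finite_permutations_of_set dest: permutations_of_setD)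
  have "inj_on (switch_index T) {..<card A}"
    by (rule inj_on_inverseI[where g = "switch_index T"]) (simp add: switch_index_switch_index)
  then have "distinct (switch T p)"
    using p switch_index_less[OF assms(2)]
    by (auto simp: distinct_conv_nth nth_switch nth_eq_iff_index_eq inj_on_def)
  moreover have "set (switch T p) \<subseteq> A"
    using p switch_index_less[OF assms(2)] by (auto simp: switch_def)
  ultimately have "set (switch T p) = A"
    using p by (intro card_subset_eq) (auto simp: distinct_card)
  with \<open>distinct (switch T p)\<close> show ?thesis by (simp add: permutations_of_set_def)
qed

text \<open>
  Let an entry belong to the pair of positions with index \<open>i\<close>. If it comes first in both lists, then
  its partner follows it in both. Otherwise, in one of the lists both entries of the next pair
  follow it; in the other list it is followed by at least one of these, since only its partner can
  come in between.
\<close>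

lemma not_two_separated_switch:
  assumes "p \<in> permutations_of_set A" "T \<subseteq> {..<card A div 2}"
  shows "\<not> two_separated p (switch T p)"
proof
  assume "two_separated p (switch T p)"
  with two_separated_iff_positions[OF assms(1) switch_permutation[OF assms]]
  obtain k l where kl: "k + 2 < card A" "l + 2 < card A" "p ! k = switch T p ! l"
    and dis: "{p ! (k + 1), p ! (k + 2)} \<inter> {switch T p ! (l + 1), switch T p ! (l + 2)} = {}"
    by blast
  have p: "length p = card A" "distinct p"
    using assms by (auto simp: length_finite_permutations_of_set dest: permutations_of_setD)
  have k: "k = switch_index T l"
    using kl p switch_index_less[OF assms(2), of l] by (simp add: nth_switch nth_eq_iff_index_eq)
  have "{k + 1, k + 2} \<inter> {switch_index T (l + 1), switch_index T (l + 2)} \<noteq> {}"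
    unfolding k switch_index_def by (cases "even l") (auto elim!: evenE oddE)
  with dis kl p show False by (auto simp: nth_switch)
qed

text \<open>The action is free: an even position already shows whether its pair was switched.\<close>

lemma switch_inj:
  assumes "distinct p" "S \<subseteq> {..<length p div 2}" "T \<subseteq> {..<length p div 2}"
    and eq: "switch S p = switch T p"
  shows "S = T"
proof -
  have "i \<in> S \<longleftrightarrow> i \<in> T" if "i < length p div 2" for i
  proof -
    have i: "2 * i < length p" using that by linarith
    have "p ! switch_index S (2 * i) = p ! switch_index T (2 * i)"
      using nth_switch[OF i, of S] nth_switch[OF i, of T] eq by simp
    then have "switch_index S (2 * i) = switch_index T (2 * i)"
      using nth_eq_iff_index_eq[OF assms(1)] switch_index_less i assms(2,3) by blast
    then show ?thesis by (auto simp: switch_index_def split: if_splits)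
  qed
  with assms show ?thesis by blast
qed

lemma card_two_separated_family_le:
  assumes "finite A" and F: "F \<subseteq> permutations_of_set A" "pairwise two_separated F"
  shows "card F * 2 ^ (card A div 2) \<le> fact (card A)"
proof -
  let ?D = "{..<card A div 2}"
  have inj: "inj_on (\<lambda>(p, T). switch T p) (F \<times> Pow ?D)"
  proof (rule inj_onI, clarify)
    fix p q S T
    assume *: "p \<in> F" "q \<in> F" "S \<subseteq> ?D" "T \<subseteq> ?D" and eq: "switch S p = switch T q"
    have perm: "p \<in> permutations_of_set A" "q \<in> permutations_of_set A" using * F by auto
    then have len: "length p = card A" "distinct p" "length q = card A"
      by (auto simp: length_finite_permutations_of_set dest: permutations_of_setD)
    (* Two members in one orbit differ by a switching, hence they are not two-separated. *)
    have "q = switch T (switch T q)" using * len by (simp add: switch_switch)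
    also have "\<dots> = switch (sym_diff S T) p" using * len by (simp add: eq[symmetric] switch_switch)
    finally have "\<not> two_separated p q"
      using not_two_separated_switch[OF perm(1), of "sym_diff S T"] * by auto
    then have "p = q" using F(2) * by (auto simp: pairwise_def)
    moreover from this have "S = T" using switch_inj[of p S T] * len eq by simp
    ultimately show "p = q \<and> S = T" by simp
  qed
  have "card (F \<times> Pow ?D) \<le> card (permutations_of_set A)"
    by (rule card_inj_on_le[OF inj]) (use F switch_permutation in \<open>auto simp: assms(1)\<close>)
  then show ?thesis using assms(1) by (simp add: card_cartesian_product card_Pow)
qed

section \<open>Lower bound: counting the permutations that are not separated from a given one\<close>

text \<open>
  A bijection that is locally almost a translation is determined by its local steps and by its
  behaviour at the last two arguments and the last two values. Equality of two bijections with the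
  same data is shown by downward induction on the argument, since a local step computes \<open>P k\<close> from
  \<open>P (k + 1)\<close> or \<open>P (k + 2)\<close>.
\<close>

lemma card_local_bijections_le:
  assumes "n \<ge> 2"
  defines "\<P> \<equiv> {P \<in> {..<n} \<rightarrow>\<^sub>E {..<n}. inj_on P {..<n} \<and>
    (\<forall>k. k + 2 < n \<and> P k + 2 < n \<longrightarrow> (\<exists>i\<in>{1,2}. \<exists>j\<in>{1,2}. P (k + i) = P k + j))}"
  shows "card \<P> \<le> n ^ 4 * 4 ^ n"
proof -
  let ?E = "{1, 2} \<times> {1, 2} :: (nat \<times> nat) set"
  have "\<exists>c. c \<in> {..<n} \<rightarrow>\<^sub>E ?E \<and>
      (\<forall>k. k + 2 < n \<and> P k + 2 < n \<longrightarrow> P (k + fst (c k)) = P k + snd (c k))" if "P \<in> \<P>" for P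
  proof -
    have "\<forall>k. \<exists>e \<in> ?E. k + 2 < n \<and> P k + 2 < n \<longrightarrow> P (k + fst e) = P k + snd e"
      using that by (fastforce simp: \<P>_def)
    then obtain c where c: "\<And>k. c k \<in> ?E"
      "\<And>k. k + 2 < n \<and> P k + 2 < n \<longrightarrow> P (k + fst (c k)) = P k + snd (c k)"
      by metis
    then show ?thesis by (intro exI[of _ "restrict c {..<n}"]) auto
  qed
  then obtain c where c: "\<And>P. P \<in> \<P> \<Longrightarrow> c P \<in> {..<n} \<rightarrow>\<^sub>E ?E"
    "\<And>P k. P \<in> \<P> \<Longrightarrow> k + 2 < n \<Longrightarrow> P k + 2 < n \<Longrightarrow> P (k + fst (c P k)) = P k + snd (c P k)"
    by metis
  (* The second components of a step are offsets of values: they stop making sense for the two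
     arguments whose values are n - 1 and n - 2, so these arguments are recorded separately. *)
  define code where "code P = (c P, P (n - 1), P (n - 2),
    inv_into {..<n} P (n - 1), inv_into {..<n} P (n - 2))" for P
  have img: "P ` {..<n} = {..<n}" if "P \<in> \<P>" for P
    using that by (intro endo_inj_surj) (auto simp: \<P>_def)
  have inj: "inj_on code \<P>"
  proof (rule inj_onI)
    fix P Q assume P: "P \<in> \<P>" and Q: "Q \<in> \<P>" and eq: "code P = code Q"
    (* Stated for fresh P and Q because it is used in both directions. *)
    have last: "Q k = P k" if "P \<in> \<P>" "Q \<in> \<P>" "code P = code Q" "k < n" "\<not> P k + 2 < n" for P Q k
    proof -
      have "P k < n" using that img by blast
      with that have m: "P k = n - 1 \<or> P k = n - 2" by linarith
      have "inv_into {..<n} P (P k) = k" using that by (simp add: \<P>_def)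
      with m that have "inv_into {..<n} Q (P k) = k" by (auto simp: code_def)
      then show ?thesis using f_inv_into_f[of "P k" Q "{..<n}"] img[of Q] that \<open>P k < n\<close> by auto
    qed
    have "P k = Q k" if "k < n" for k
      using that
    proof (induction "n - k" arbitrary: k rule: less_induct)
      case less
      consider "\<not> k + 2 < n" | "\<not> P k + 2 < n" | "\<not> Q k + 2 < n"
        | "k + 2 < n" "P k + 2 < n" "Q k + 2 < n" by blast
      then show ?case
      proof cases
        case 1
        with less have "k = n - 1 \<or> k = n - 2" by linarith
        then show ?thesis using eq by (auto simp: code_def)
      next
        case 2 then show ?thesis using last[OF P Q eq] less by simp
      next
        case 3 then show ?thesis using last[OF Q P eq[symmetric]] less by simp
      next
        case 4
        have cc: "c P = c Q" using eq by (simp add: code_def)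
        have e: "c P k \<in> ?E" using c(1)[OF P] less by auto
        with 4 have "P (k + fst (c P k)) = Q (k + fst (c P k))"
          by (intro less.hyps) auto
        then show ?thesis using c(2)[OF P] c(2)[OF Q] 4 cc by simp
      qed
    qed
    then show "P = Q"
      using P Q by (intro PiE_ext[of _ "{..<n}" "\<lambda>_. {..<n}"]) (auto simp: \<P>_def)
  qed
  let ?C = "({..<n} \<rightarrow>\<^sub>E ?E) \<times> {..<n} \<times> {..<n} \<times> {..<n} \<times> {..<n}"
  have "inv_into {..<n} P m < n" if "P \<in> \<P>" "m < n" for P m
    using inv_into_into[of m P "{..<n}"] img[OF that(1)] that by auto
  then have "code ` \<P> \<subseteq> ?C"
    using c(1) assms(1) by (auto simp: code_def \<P>_def)
  then have "card \<P> \<le> card ?C"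
    by (intro card_inj_on_le[OF inj]) (auto intro!: finite_PiE)
  also have "\<dots> = n ^ 4 * 4 ^ n"
  proof -
    have "card ?E = 4" by (simp add: card_cartesian_product)
    then have "card ({..<n} \<rightarrow>\<^sub>E ?E) = 4 ^ n"
      by (simp only: card_PiE finite_lessThan prod_constant card_lessThan)
    then show ?thesis by (simp only: card_cartesian_product card_lessThan power4_eq_xxxx mult_ac)
  qed
  finally show ?thesis .
qed

lemma card_not_two_separated_le:
  assumes "card A \<ge> 2" and q: "q \<in> permutations_of_set A"
  shows "card {p \<in> permutations_of_set A. \<not> two_separated q p} \<le> card A ^ 4 * 4 ^ card A"
proof -
  let ?n = "card A"
  let ?B = "{p \<in> permutations_of_set A. \<not> two_separated q p}"
  let ?PP = "{P \<in> {..<?n} \<rightarrow>\<^sub>E {..<?n}. inj_on P {..<?n} \<and>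
    (\<forall>k. k + 2 < ?n \<and> P k + 2 < ?n \<longrightarrow> (\<exists>i\<in>{1,2}. \<exists>j\<in>{1,2}. P (k + i) = P k + j))}"
  have q': "length q = ?n" "distinct q" "set q = A"
    using q by (auto simp: length_finite_permutations_of_set dest: permutations_of_setD)
  define pos where "pos p = (\<lambda>k \<in> {..<?n}. inv_into {..<?n} ((!) p) (q ! k))" for p
  have pos: "pos p k < ?n" "p ! pos p k = q ! k"
    if "p \<in> permutations_of_set A" "k < ?n" for p k
  proof -
    have "length p = ?n" "set p = A" using that by (auto simp: length_finite_permutations_of_set dest: permutations_of_setD)
    then have "q ! k \<in> (!) p ` {..<?n}" using q' that
      by (metis in_set_conv_nth imageI lessThan_iff)
    then show "pos p k < ?n" "p ! pos p k = q ! k"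
      using that inv_into_into[of "q ! k" "(!) p" "{..<?n}"] f_inv_into_f[of "q ! k" "(!) p" "{..<?n}"]
      by (auto simp: pos_def)
  qed
  have inj_pos: "inj_on (pos p) {..<?n}" if "p \<in> permutations_of_set A" for p
  proof (rule inj_onI)
    fix k l assume "k \<in> {..<?n}" "l \<in> {..<?n}" "pos p k = pos p l"
    then have "q ! k = q ! l" using pos(2)[OF that] by (metis lessThan_iff)
    then show "k = l" using q' \<open>k \<in> {..<?n}\<close> \<open>l \<in> {..<?n}\<close> by (simp add: nth_eq_iff_index_eq)
  qed
  have "inj_on pos ?B"
  proof (rule inj_onI)
    fix p r assume "p \<in> ?B" "r \<in> ?B" and eq: "pos p = pos r"
    then have pr: "p \<in> permutations_of_set A" "r \<in> permutations_of_set A" by auto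
    then have len: "length p = ?n" "length r = ?n" by (auto simp: length_finite_permutations_of_set dest: permutations_of_setD)
    have surj: "pos p ` {..<?n} = {..<?n}"
      using pos(1) pr by (intro endo_inj_surj inj_pos) auto
    show "p = r"
    proof (rule nth_equalityI)
      fix m assume "m < length p"
      then obtain k where "k < ?n" "m = pos p k" using surj len by (metis imageE lessThan_iff)
      then show "p ! m = r ! m" using pos(2) pr eq by metis
    qed (simp add: len)
  qed
  moreover have "pos ` ?B \<subseteq> ?PP"
  proof
    fix P assume "P \<in> pos ` ?B"
    then obtain p where p: "p \<in> permutations_of_set A" "\<not> two_separated q p" and P: "P = pos p"
      by blast
    have p': "length p = ?n" "distinct p" using p by (auto simp: length_finite_permutations_of_set dest: permutations_of_setD)
    have "\<exists>i\<in>{1,2}. \<exists>j\<in>{1,2}. pos p (k + i) = pos p k + j" if k: "k + 2 < ?n" "pos p k + 2 < ?n" for k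
    proof -
      have "q ! k = p ! pos p k" using pos(2)[OF p(1), of k] k by simp
      then have "{q ! (k + 1), q ! (k + 2)} \<inter> {p ! (pos p k + 1), p ! (pos p k + 2)} \<noteq> {}"
        using two_separated_iff_positions[OF q p(1)] p(2) k by blast
      then obtain i j where ij: "i \<in> {1, 2}" "j \<in> {1, 2}" "q ! (k + i) = p ! (pos p k + j)" by blast
      then have "k + i < ?n" "pos p k + j < ?n" using k by auto
      then have "pos p (k + i) = pos p k + j"
        using pos[OF p(1), of "k + i"] ij p' by (simp add: nth_eq_iff_index_eq)
      with ij show ?thesis by blast
    qed
    moreover have "pos p \<in> {..<?n} \<rightarrow>\<^sub>E {..<?n}"
      using pos(1)[OF p(1)] by (auto simp: pos_def)
    ultimately show "P \<in> ?PP" using P inj_pos[OF p(1)] by blast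
  qed
  moreover have "finite ?PP" by (rule finite_subset[of _ "{..<?n} \<rightarrow>\<^sub>E {..<?n}"]) (auto intro: finite_PiE)
  ultimately have "card ?B \<le> card ?PP" by (rule card_inj_on_le)
  also have "\<dots> \<le> ?n ^ 4 * 4 ^ ?n" by (rule card_local_bijections_le[OF assms(1)])
  finally show ?thesis .
qed

section \<open>The bounds on R\<close>

lemma R_attained:
  assumes "n \<ge> 1"
  obtains F where "F \<subseteq> permutations_of_set {1..n}" "pairwise two_separated F" "card F = R n"
    "\<And>G. G \<subseteq> permutations_of_set {1..n} \<Longrightarrow> pairwise two_separated G \<Longrightarrow> card G \<le> R n"
proof -
  let ?S = "{F. F \<subseteq> permutations_of_set {1..n} \<and> pairwise two_separated F}"
  have R: "R n = Max (card ` ?S)"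
    by (simp only: R_def hamilton_paths_K_sym[OF assms])
  have fin: "finite ?S" by simp
  have "{} \<in> ?S" by simp
  then have "Max (card ` ?S) \<in> card ` ?S" by (intro Max_in) (use fin in auto)
  then obtain F where "F \<in> ?S" "card F = R n" using R by auto
  moreover have "card G \<le> R n" if "G \<in> ?S" for G
    unfolding R using that fin by (intro Max_ge) auto
  ultimately show ?thesis using that by blast
qed

text \<open>
  A permutation outside every ball around the members of a maximum family could be added to it.
\<close>

lemma fact_le_R_times_ball:
  assumes "n \<ge> 2"
  shows "fact n \<le> R n * (n ^ 4 * 4 ^ n)"
proof -
  let ?S = "permutations_of_set {1..n}"
  obtain F where F: "F \<subseteq> ?S" "pairwise two_separated F" "card F = R n"
    and max: "\<And>G. G \<subseteq> ?S \<Longrightarrow> pairwise two_separated G \<Longrightarrow> card G \<le> R n"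
    using R_attained[of n] assms by auto
  have finF: "finite F" using F(1) by (rule finite_subset) simp
  have not_refl: "\<not> two_separated p p" if "p \<in> ?S" for p
    using not_two_separated_switch[OF that, of "{}"] by simp
  have "?S \<subseteq> (\<Union>q\<in>F. {p \<in> ?S. \<not> two_separated q p})"
  proof
    fix p assume p: "p \<in> ?S"
    show "p \<in> (\<Union>q\<in>F. {p \<in> ?S. \<not> two_separated q p})"
    proof (rule ccontr)
      assume "p \<notin> (\<Union>q\<in>F. {p \<in> ?S. \<not> two_separated q p})"
      with p have sep: "two_separated q p" if "q \<in> F" for q using that by blast
      then have "p \<notin> F" using not_refl p by blast
      moreover have "pairwise two_separated (insert p F)"
        using F(2) sep two_separated_sym by (auto simp: pairwise_insert)
      then have "card (insert p F) \<le> R n" using F(1) p by (intro max) auto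
      ultimately show False using F(3) finF by simp
    qed
  qed
  then have "card ?S \<le> card (\<Union>q\<in>F. {p \<in> ?S. \<not> two_separated q p})"
    by (intro card_mono) (use finF in auto)
  also have "\<dots> \<le> (\<Sum>q\<in>F. card {p \<in> ?S. \<not> two_separated q p})"
    by (rule card_UN_le[OF finF])
  also have "\<dots> \<le> (\<Sum>q\<in>F. n ^ 4 * 4 ^ n)"
  proof (rule sum_mono)
    fix q assume "q \<in> F"
    then show "card {p \<in> ?S. \<not> two_separated q p} \<le> n ^ 4 * 4 ^ n"
      using card_not_two_separated_le[of "{1..n}" q] F(1) assms by auto
  qed
  finally show ?thesis using F(3) by simp
qed

theorem theorem2:
  fixes n :: nat
  assumes "n \<ge> 3"
  shows "fact n / (real n ^ 13 * 5 powi (int n - 10)) \<le> real (R n) \<and>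
    real (R n) \<le> fact n / 2 ^ (n div 2)"
proof
  have n: "n \<ge> 2" "n \<ge> 1" using assms by auto
  have ball: "fact n \<le> R n * (n ^ 4 * 4 ^ n)" by (rule fact_le_R_times_ball[OF n(1)])
  have "fact n * 5 ^ 10 \<le> R n * (n ^ 13 * 5 ^ n)"
  proof (cases "n \<ge> 6")
    case True
    have "(5::nat) ^ 10 \<le> 6 ^ 9" by simp
    also have "\<dots> \<le> n ^ 9" using True by (rule power_mono) simp
    finally have "(4 ^ n * n ^ 4) * 5 ^ 10 \<le> (5 ^ n * n ^ 4) * n ^ 9"
      by (intro mult_mono power_mono) auto
    also have "\<dots> = n ^ 13 * 5 ^ n" by (simp add: algebra_simps flip: power_add)
    finally have "R n * (4 ^ n * n ^ 4 * 5 ^ 10) \<le> R n * (n ^ 13 * 5 ^ n)" by (rule mult_left_mono) simp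
    moreover have "fact n * 5 ^ 10 \<le> R n * (n ^ 4 * 4 ^ n) * 5 ^ 10" using ball by (rule mult_right_mono) simp
    ultimately show ?thesis by (simp only: mult_ac)
  next
    case False
    have "R n \<noteq> 0" using ball by (intro notI) simp
    have "n = 3 \<or> n = 4 \<or> n = 5" using False assms by linarith
    then have "fact n * 5 ^ 10 \<le> 1 * (n ^ 13 * 5 ^ n)" by (auto simp: fact_numeral)
    also have "\<dots> \<le> R n * (n ^ 13 * 5 ^ n)"
      using \<open>R n \<noteq> 0\<close> by (intro mult_right_mono) auto
    finally show ?thesis .
  qed
  then have "real (fact n * 5 ^ 10) \<le> real (R n * (n ^ 13 * 5 ^ n))" by (rule of_nat_mono)
  moreover have powi: "(5::real) powi (int n - 10) = 5 ^ n / 5 ^ 10"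
    by (simp add: power_int_diff)
  ultimately show "fact n / (real n ^ 13 * 5 powi (int n - 10)) \<le> real (R n)"
    unfolding powi using assms by (simp add: field_simps)
next
  have "n \<ge> 1" using assms by simp
  then obtain F where "F \<subseteq> permutations_of_set {1..n}" "pairwise two_separated F" "card F = R n"
    by (rule R_attained)
  with card_two_separated_family_le[of "{1..n}" F] have "R n * 2 ^ (n div 2) \<le> fact n" by simp
  then have "real (R n * 2 ^ (n div 2)) \<le> real (fact n)" by (rule of_nat_mono)
  then show "real (R n) \<le> fact n / 2 ^ (n div 2)" by (simp add: field_simps)
qed

end
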